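(* Let $(V,* )$ be a finite travel groupoid. Then the following statements are equivalent: (1) $(V,* )$ is on a complete multipartite graph (i.e. its associated graph $G_V$ is a complete multipartite graph); (2) every maximal associative subgroupoid $W$ of $V$ satisfies that, for all $v\in V\setminus W$, there is $w\in W$ such that $(W\setminus\{w\})\cup\{v\}$ is a maximal associative subgroupoid of $V$.
   Context: A groupoid $(V,* )$ is a nonempty set $V$ with a binary operation $*:V\times V\to V$. It is a travel groupoid if (t1) $(u*v)*u=u$ for all $u,v\in V$, and (t2) for all $u,v\in V$, if $(u*v)*v=u$ then $u=v$. The associated graph $G_V$ of a travel groupoid has vertex set $V$ and edge set $\{\{u,v\} : u,v\in V,\ u\neq u*v=v\}$; $(V,* )$ is said to be on a graph $G$ if $G=G_V$. Graphs are finite, undirected, with no multiple edges or loops. A complete multipartite graph with $l$ parts is a graph whose vertex set is partitioned into $l\ge 1$ nonempty independent sets $V_1,\dots,V_l$, with an edge between every pair of vertices from different independent sets. A subgroupoid of $(V,* )$ is a (nonempty) subset of $V$ closed under $*$; it is associative if $(x*y)*z=x*(y*z)$ for all its elements $x,y,z$. A maximal associative subgroupoid is an associative subgroupoid that is maximal with respect to inclusion among associative subgroupoids of $V$. *)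

theory Defs
  imports Main "HOL-Library.Disjoint_Sets"
begin

locale groupoid =
  fixes V :: "'a set" and mult :: "'a \<Rightarrow> 'a \<Rightarrow> 'a" (infixl "\<star>" 70)
  assumes nonempty: "V \<noteq> {}"
    and closed: "u \<in> V \<Longrightarrow> v \<in> V \<Longrightarrow> u \<star> v \<in> V"

locale travel_groupoid = groupoid +
  assumes t1: "u \<in> V \<Longrightarrow> v \<in> V \<Longrightarrow> (u \<star> v) \<star> u = u"
    and t2: "u \<in> V \<Longrightarrow> v \<in> V \<Longrightarrow> (u \<star> v) \<star> v = u \<Longrightarrow> u = v"

text \<open>A graph is a pair of a vertex set and a set of edges, each edge being an unordered pair
  of distinct vertices represented as a two-element set.\<close>

type_synonym 'a graph = "'a set \<times> 'a set set"

abbreviation verts :: "'a graph \<Rightarrow> 'a set" where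
  "verts G \<equiv> fst G"

abbreviation edges :: "'a graph \<Rightarrow> 'a set set" where
  "edges G \<equiv> snd G"

definition finite_simple_graph :: "'a graph \<Rightarrow> bool" where
  "finite_simple_graph G \<longleftrightarrow> finite (verts G) \<and> (\<forall>e\<in>edges G. e \<subseteq> verts G \<and> card e = 2)"

definition independent_set :: "'a graph \<Rightarrow> 'a set \<Rightarrow> bool" where
  "independent_set G A \<longleftrightarrow> A \<subseteq> verts G \<and> (\<forall>a\<in>A. \<forall>b\<in>A. {a, b} \<notin> edges G)"

text \<open>The parts are nonempty by \<^const>\<open>partition_on\<close>, and there are finitely many of them
  because the vertex set is finite.\<close>

definition complete_multipartite :: "'a graph \<Rightarrow> bool" where
  "complete_multipartite G \<longleftrightarrow> finite_simple_graph G \<and>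
     (\<exists>P. partition_on (verts G) P \<and> P \<noteq> {} \<and>
          (\<forall>A\<in>P. independent_set G A) \<and>
          (\<forall>A\<in>P. \<forall>B\<in>P. A \<noteq> B \<longrightarrow> (\<forall>a\<in>A. \<forall>b\<in>B. {a, b} \<in> edges G)))"

definition associated_graph :: "'a set \<Rightarrow> ('a \<Rightarrow> 'a \<Rightarrow> 'a) \<Rightarrow> 'a graph" where
  "associated_graph V mult =
     (V, {{u, v} | u v. u \<in> V \<and> v \<in> V \<and> u \<noteq> mult u v \<and> mult u v = v})"

definition on_graph :: "'a set \<Rightarrow> ('a \<Rightarrow> 'a \<Rightarrow> 'a) \<Rightarrow> 'a graph \<Rightarrow> bool" where
  "on_graph V mult G \<longleftrightarrow> G = associated_graph V mult"

definition subgroupoid :: "'a set \<Rightarrow> ('a \<Rightarrow> 'a \<Rightarrow> 'a) \<Rightarrow> 'a set \<Rightarrow> bool" where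
  "subgroupoid V mult W \<longleftrightarrow> W \<noteq> {} \<and> W \<subseteq> V \<and> (\<forall>x\<in>W. \<forall>y\<in>W. mult x y \<in> W)"

definition assoc_subgroupoid :: "'a set \<Rightarrow> ('a \<Rightarrow> 'a \<Rightarrow> 'a) \<Rightarrow> 'a set \<Rightarrow> bool" where
  "assoc_subgroupoid V mult W \<longleftrightarrow> subgroupoid V mult W \<and>
     (\<forall>x\<in>W. \<forall>y\<in>W. \<forall>z\<in>W. mult (mult x y) z = mult x (mult y z))"

definition maximal_assoc_subgroupoid :: "'a set \<Rightarrow> ('a \<Rightarrow> 'a \<Rightarrow> 'a) \<Rightarrow> 'a set \<Rightarrow> bool" where
  "maximal_assoc_subgroupoid V mult W \<longleftrightarrow> assoc_subgroupoid V mult W \<and>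
     (\<forall>W'. assoc_subgroupoid V mult W' \<and> W \<subseteq> W' \<longrightarrow> W' = W)"

end

theory Submission
  imports Defs
begin

text \<open>The associative subgroupoids are exactly the nonempty cliques of the associated graph:
  if (x * y) * x = x * (y * x), then (t1) gives x * (y * x) = x, which forces y * x = x.
  A graph is complete multipartite iff non-adjacency is transitive. If it is, a vertex v outside a
  maximal clique W has a non-neighbour w in W, and v can replace w. Conversely, if b is
  non-adjacent to two adjacent vertices a and c, then b cannot be exchanged into a
  maximal clique containing a and c, as one of these two remains.\<close>

context travel_groupoid
begin

text \<open>By (t1), \<open>(u \<star> u) \<star> u = u\<close>, so multiplying
  \<open>u \<star> u\<close> on the right by \<open>u\<close> twice returns
  \<open>u \<star> u\<close>; (t2) then identifies the two.\<close>

lemma idem: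
  assumes "u \<in> V"
  shows "u \<star> u = u"
  using assms by (intro t2[of "u \<star> u" u]) (simp_all add: closed t1)

lemma mult_eq_left:
  assumes "u \<in> V" "v \<in> V" "u \<star> v = u"
  shows "u = v"
  using assms t2[of u v] by simp

text \<open>Substituting \<open>u \<star> v = v\<close> into (t1) suffices. This symmetry lets a
  single ordered product decide adjacency.\<close>

lemma mult_eq_right_sym:
  assumes "u \<in> V" "v \<in> V" "u \<star> v = v"
  shows "v \<star> u = u"
  using assms t1[of u v] by simp

lemma verts_associated_graph: "verts (associated_graph V (\<star>)) = V"
  by (simp add: associated_graph_def)

lemma edge_iff:
  "{u, v} \<in> edges (associated_graph V (\<star>)) \<longleftrightarrow> u \<in> V \<and> v \<in> V \<and> u \<noteq> v \<and> u \<star> v = v"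
  using mult_eq_right_sym[of u v] mult_eq_right_sym[of v u]
  unfolding associated_graph_def snd_conv mem_Collect_eq doubleton_eq_iff by metis

text \<open>The case \<open>x = y\<close> is idempotence, so the condition on products says that
  \<open>W\<close> is a clique. Conversely, if every product equals its right factor, closure is
  immediate and both bracketings of a triple give its last element.\<close>

lemma assoc_subgroupoid_iff:
  "assoc_subgroupoid V (\<star>) W \<longleftrightarrow> W \<noteq> {} \<and> W \<subseteq> V \<and> (\<forall>x\<in>W. \<forall>y\<in>W. x \<star> y = y)"
proof
  assume W: "assoc_subgroupoid V (\<star>) W"
  have "y \<star> x = x" if "x \<in> W" "y \<in> W" for x y
  proof -
    have V: "x \<in> V" "y \<in> V"
      using W that by (auto simp: assoc_subgroupoid_def subgroupoid_def)
    have "x \<star> (y \<star> x) = x"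
      using W that t1[OF V] by (auto simp: assoc_subgroupoid_def)
    then show ?thesis
      using mult_eq_left V closed by metis
  qed
  then show "W \<noteq> {} \<and> W \<subseteq> V \<and> (\<forall>x\<in>W. \<forall>y\<in>W. x \<star> y = y)"
    using W by (auto simp: assoc_subgroupoid_def subgroupoid_def)
qed (simp add: assoc_subgroupoid_def subgroupoid_def)

text \<open>Only products with \<open>v\<close> on the right need checking: symmetry supplies those
  with \<open>v\<close> on the left, and \<open>idem\<close> supplies
  \<open>v \<star> v\<close>.\<close>

lemma assoc_subgroupoid_insert:
  assumes "W \<subseteq> V" "v \<in> V" "\<And>x y. x \<in> W \<Longrightarrow> y \<in> W \<Longrightarrow> x \<star> y = y" "\<And>x. x \<in> W \<Longrightarrow> x \<star> v = v"
  shows "assoc_subgroupoid V (\<star>) (insert v W)"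
proof -
  have "v \<star> x = x" if "x \<in> W" for x
    using assms that mult_eq_right_sym[of x v] by auto
  then show ?thesis
    using assms by (auto simp: assoc_subgroupoid_iff idem)
qed

text \<open>Every element of a larger clique is adjacent to all of \<open>W\<close>, so maximality
  can be tested by adding one vertex at a time.\<close>

lemma maximal_assoc_subgroupoid_iff:
  "maximal_assoc_subgroupoid V (\<star>) W \<longleftrightarrow>
    assoc_subgroupoid V (\<star>) W \<and> (\<forall>v\<in>V. (\<forall>x\<in>W. x \<star> v = v) \<longrightarrow> v \<in> W)"
proof
  assume *: "maximal_assoc_subgroupoid V (\<star>) W"
  then have W: "assoc_subgroupoid V (\<star>) W"
    by (simp add: maximal_assoc_subgroupoid_def)
  have "v \<in> W" if "v \<in> V" "\<forall>x\<in>W. x \<star> v = v" for v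
  proof -
    have "assoc_subgroupoid V (\<star>) (insert v W)"
      using W that by (intro assoc_subgroupoid_insert) (auto simp: assoc_subgroupoid_iff)
    then have "insert v W = W"
      using * unfolding maximal_assoc_subgroupoid_def by blast
    then show ?thesis by blast
  qed
  with W show "assoc_subgroupoid V (\<star>) W \<and> (\<forall>v\<in>V. (\<forall>x\<in>W. x \<star> v = v) \<longrightarrow> v \<in> W)"
    by blast
next
  assume *: "assoc_subgroupoid V (\<star>) W \<and> (\<forall>v\<in>V. (\<forall>x\<in>W. x \<star> v = v) \<longrightarrow> v \<in> W)"
  have "W' \<subseteq> W" if "assoc_subgroupoid V (\<star>) W'" "W \<subseteq> W'" for W'
  proof
    fix v assume "v \<in> W'"
    with that have "v \<in> V" "\<forall>x\<in>W. x \<star> v = v"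
      unfolding assoc_subgroupoid_iff by blast+
    with * show "v \<in> W" by blast
  qed
  with * show "maximal_assoc_subgroupoid V (\<star>) W"
    unfolding maximal_assoc_subgroupoid_def by blast
qed

lemma maximal_assoc_subgroupoid_extends:
  assumes "finite V" "assoc_subgroupoid V (\<star>) W"
  obtains M where "maximal_assoc_subgroupoid V (\<star>) M" "W \<subseteq> M"
proof -
  have "finite {W. assoc_subgroupoid V (\<star>) W}"
    by (rule finite_subset[of _ "Pow V"]) (use assms(1) in \<open>auto simp: assoc_subgroupoid_iff\<close>)
  from finite_has_maximal2[OF this, of W] assms(2) obtain M
    where "assoc_subgroupoid V (\<star>) M" "W \<subseteq> M"
      "\<forall>W'. assoc_subgroupoid V (\<star>) W' \<longrightarrow> M \<subseteq> W' \<longrightarrow> M = W'"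
    by auto
  then show thesis
    using that unfolding maximal_assoc_subgroupoid_def by metis
qed

lemma finite_simple_associated_graph:
  assumes "finite V"
  shows "finite_simple_graph (associated_graph V (\<star>))"
proof -
  have "card {u, v} = 2" if "u \<in> V" "v \<in> V" "u \<noteq> u \<star> v" "u \<star> v = v" for u v
    using that by simp
  then show ?thesis
    using assms unfolding finite_simple_graph_def associated_graph_def by auto
qed

text \<open>Since u * u = u, the relation u * v \<noteq> v means that u and v are distinct and
  non-adjacent.\<close>

lemma complete_multipartite_iff:
  assumes "finite V"
  shows "complete_multipartite (associated_graph V (\<star>)) \<longleftrightarrow>
    (\<forall>a\<in>V. \<forall>b\<in>V. \<forall>c\<in>V. a \<star> b \<noteq> b \<longrightarrow> b \<star> c \<noteq> c \<longrightarrow> a \<noteq> c \<longrightarrow> a \<star> c \<noteq> c)"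
    (is "?L \<longleftrightarrow> ?R")
proof
  assume ?L
  then obtain P where P: "partition_on V P"
    and ind: "\<forall>A\<in>P. independent_set (associated_graph V (\<star>)) A"
    and adj: "\<forall>A\<in>P. \<forall>B\<in>P. A \<noteq> B \<longrightarrow>
      (\<forall>a\<in>A. \<forall>b\<in>B. {a, b} \<in> edges (associated_graph V (\<star>)))"
    unfolding complete_multipartite_def verts_associated_graph by blast
  show ?R
  proof (intro ballI impI)
    fix a b c assume V: "a \<in> V" "b \<in> V" "c \<in> V"
      and *: "a \<star> b \<noteq> b" "b \<star> c \<noteq> c" "a \<noteq> c"
    have "V = \<Union>P"
      using P by (rule partition_onD1)
    with V obtain A B C where parts: "A \<in> P" "B \<in> P" "C \<in> P" "a \<in> A" "b \<in> B" "c \<in> C"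
      by blast
    \<comment> \<open>Vertices in different parts would be adjacent.\<close>
    have "A = B"
      using adj parts * unfolding edge_iff by blast
    moreover have "B = C"
      using adj parts * unfolding edge_iff by blast
    ultimately have "{a, c} \<notin> edges (associated_graph V (\<star>))"
      using ind parts unfolding independent_set_def by blast
    with V * show "a \<star> c \<noteq> c"
      by (simp add: edge_iff)
  qed
next
  assume R: ?R
  \<comment> \<open>The parts will be the classes of \<open>r\<close>. Equality is added because
    idempotence keeps \<open>x \<star> y \<noteq> y\<close> from ever holding on the diagonal; a
    pair outside \<open>r\<close> is thus distinct and adjacent.\<close>
  define r where "r = {(x, y). x \<in> V \<and> y \<in> V \<and> (x = y \<or> x \<star> y \<noteq> y)}"
  have "equiv V r"
  proof (rule equivI)
    show "r \<subseteq> V \<times> V" "refl_on V r"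
      by (auto simp: r_def refl_on_def)
    show "sym r"
      unfolding r_def sym_def using mult_eq_right_sym by blast
    show "trans r"
      unfolding r_def trans_def using R by auto
  qed
  then have P: "partition_on V (V // r)"
    by (rule partition_on_quotient)
  have ind: "independent_set (associated_graph V (\<star>)) A" if "A \<in> V // r" for A
  proof -
    have "A \<subseteq> V"
      using P that by (auto simp: partition_on_def)
    moreover have "(a, b) \<in> r" if "a \<in> A" "b \<in> A" for a b
      using quotient_eq_iff[OF \<open>equiv V r\<close> \<open>A \<in> V // r\<close> \<open>A \<in> V // r\<close> that] by simp
    ultimately show ?thesis
      by (auto simp: independent_set_def edge_iff verts_associated_graph r_def)
  qed
  have adj: "{a, b} \<in> edges (associated_graph V (\<star>))"
    if "A \<in> V // r" "B \<in> V // r" "A \<noteq> B" "a \<in> A" "b \<in> B" for A B a b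
  proof -
    have "a \<in> V" "b \<in> V"
      using P that by (auto simp: partition_on_def)
    moreover have "(a, b) \<notin> r"
      using quotient_eq_iff[OF \<open>equiv V r\<close> that(1,2,4,5)] that(3) by simp
    ultimately show ?thesis
      by (auto simp: edge_iff r_def)
  qed
  have "V // r \<noteq> {}"
    using nonempty by (simp add: quotient_is_empty)
  with P ind adj finite_simple_associated_graph[OF assms] show ?L
    unfolding complete_multipartite_def verts_associated_graph
    by (intro conjI exI[of _ "V // r"]) blast+
qed

text \<open>Transitivity makes the non-adjacent vertices \<open>v\<close> and \<open>w\<close> have
  the same neighbours, so swapping them preserves both the clique property and maximality.\<close>

lemma exchange_if_nonadjacency_transitive:
  assumes tr: "\<And>a b c. a \<in> V \<Longrightarrow> b \<in> V \<Longrightarrow> c \<in> V \<Longrightarrow>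
      a \<star> b \<noteq> b \<Longrightarrow> b \<star> c \<noteq> c \<Longrightarrow> a \<noteq> c \<Longrightarrow> a \<star> c \<noteq> c"
    and W: "maximal_assoc_subgroupoid V (\<star>) W" and v: "v \<in> V - W"
  shows "\<exists>w\<in>W. maximal_assoc_subgroupoid V (\<star>) ((W - {w}) \<union> {v})"
proof -
  have sub: "W \<subseteq> V" and clique: "\<And>x y. x \<in> W \<Longrightarrow> y \<in> W \<Longrightarrow> x \<star> y = y"
    and max: "\<And>x. x \<in> V \<Longrightarrow> (\<And>y. y \<in> W \<Longrightarrow> y \<star> x = x) \<Longrightarrow> x \<in> W"
    using W by (auto simp: maximal_assoc_subgroupoid_iff assoc_subgroupoid_iff)
  \<comment> \<open>A \<open>w\<close> that is missing here would make \<open>v\<close> adjacent to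
    all of \<open>W\<close>, hence a member of it.\<close>
  from max[of v] v obtain w where w: "w \<in> W" "w \<star> v \<noteq> v"
    by blast
  \<comment> \<open>Otherwise \<open>x\<close> and \<open>w\<close>, both non-adjacent to
    \<open>v\<close>, would be non-adjacent to each other inside the clique
    \<open>W\<close>.\<close>
  have adj: "x \<star> v = v" if "x \<in> W - {w}" for x
    using tr[of x v w] clique w v that sub mult_eq_right_sym by blast
  have "assoc_subgroupoid V (\<star>) (insert v (W - {w}))"
    using sub v clique adj by (intro assoc_subgroupoid_insert) auto
  moreover have "x \<in> insert v (W - {w})"
    if x: "x \<in> V" "\<forall>y\<in>insert v (W - {w}). y \<star> x = x" for x
  proof (cases "x = v")
    case False
    have "w \<star> x = x"
    proof (rule ccontr)
      assume "w \<star> x \<noteq> x"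
      then have "v \<star> x \<noteq> x"
        using tr[of v w x] w v x sub False mult_eq_right_sym by blast
      with x show False by blast
    qed
    with x have "x \<in> W"
      by (intro max) auto
    \<comment> \<open>\<open>x\<close> satisfies \<open>v \<star> x = x\<close>, whereas
      \<open>w\<close> is non-adjacent to \<open>v\<close>.\<close>
    moreover have "x \<noteq> w"
      using x w v sub mult_eq_right_sym by blast
    ultimately show ?thesis by blast
  qed simp
  ultimately have "maximal_assoc_subgroupoid V (\<star>) (insert v (W - {w}))"
    by (simp add: maximal_assoc_subgroupoid_iff)
  with w(1) show ?thesis by auto
qed

lemma nonadjacency_transitive_if_exchange:
  assumes "finite V"
    and ex: "\<And>W v. maximal_assoc_subgroupoid V (\<star>) W \<Longrightarrow> v \<in> V - W \<Longrightarrow>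
      \<exists>w\<in>W. maximal_assoc_subgroupoid V (\<star>) ((W - {w}) \<union> {v})"
    and V: "a \<in> V" "b \<in> V" "c \<in> V"
    and nonadj: "a \<star> b \<noteq> b" "b \<star> c \<noteq> c" and "a \<noteq> c"
  shows "a \<star> c \<noteq> c"
proof
  assume "a \<star> c = c"
  then have "assoc_subgroupoid V (\<star>) {a, c}"
    using V mult_eq_right_sym[of a c] by (auto simp: assoc_subgroupoid_iff idem)
  then obtain W where W: "maximal_assoc_subgroupoid V (\<star>) W" "{a, c} \<subseteq> W"
    using maximal_assoc_subgroupoid_extends[OF assms(1)] by metis
  then have "b \<notin> W"
    using nonadj by (auto simp: maximal_assoc_subgroupoid_iff assoc_subgroupoid_iff)
  with ex[OF W(1)] V obtain w where "maximal_assoc_subgroupoid V (\<star>) ((W - {w}) \<union> {b})"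
    by blast
  \<comment> \<open>As \<open>a \<noteq> c\<close>, one of them survives the removal of
    \<open>w\<close>. Both product orders are recorded because \<open>nonadj\<close> has
    \<open>b\<close> on the right of \<open>a\<close> but on the left of \<open>c\<close>.\<close>
  then have "\<forall>x\<in>W - {w}. x \<star> b = b \<and> b \<star> x = x"
    by (auto simp: maximal_assoc_subgroupoid_iff assoc_subgroupoid_iff)
  with W(2) nonadj \<open>a \<noteq> c\<close> show False
    by blast
qed

end

theorem theorem4p4:
  fixes V :: "'a set" and mult :: "'a \<Rightarrow> 'a \<Rightarrow> 'a"
  assumes "travel_groupoid V mult" and "finite V"
  shows "(\<exists>G. complete_multipartite G \<and> on_graph V mult G) \<longleftrightarrow>
    (\<forall>W. maximal_assoc_subgroupoid V mult W \<longrightarrow>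
      (\<forall>v \<in> V - W. \<exists>w \<in> W. maximal_assoc_subgroupoid V mult ((W - {w}) \<union> {v})))"
    (is "?L \<longleftrightarrow> ?R")
proof -
  interpret travel_groupoid V mult by fact
  \<comment> \<open>\<open>on_graph\<close> determines \<open>G\<close>, so the existential reduces
    to a statement about the associated graph.\<close>
  have L: "?L \<longleftrightarrow> (\<forall>a\<in>V. \<forall>b\<in>V. \<forall>c\<in>V.
      mult a b \<noteq> b \<longrightarrow> mult b c \<noteq> c \<longrightarrow> a \<noteq> c \<longrightarrow> mult a c \<noteq> c)"
    unfolding on_graph_def complete_multipartite_iff[OF \<open>finite V\<close>, symmetric] by blast
  show ?thesis
  proof
    assume ?L
    then have tr: "mult a c \<noteq> c"
      if "a \<in> V" "b \<in> V" "c \<in> V" "mult a b \<noteq> b" "mult b c \<noteq> c" "a \<noteq> c" for a b c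
      using L that by blast
    show ?R
    proof (intro allI impI ballI)
      fix W v assume "maximal_assoc_subgroupoid V mult W" "v \<in> V - W"
      from exchange_if_nonadjacency_transitive[OF _ this] tr
      show "\<exists>w\<in>W. maximal_assoc_subgroupoid V mult ((W - {w}) \<union> {v})"
        by metis
    qed
  next
    assume R: ?R
    show ?L
      unfolding L
    proof (intro ballI impI)
      fix a b c
      assume "a \<in> V" "b \<in> V" "c \<in> V" "mult a b \<noteq> b" "mult b c \<noteq> c" "a \<noteq> c"
      from nonadjacency_transitive_if_exchange[OF \<open>finite V\<close> _ this] R
      show "mult a c \<noteq> c"
        by simp
    qed
  qed
qed

end
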